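(* Let $(M,p_0)$ be a based metric space that is Lipschitz path connected and has more than one element. If the base point $p_0$ supports only trivial local representation, then the lifted pseudo-metric $d_{\mathcal{P}}$ restricted to the first Lipschitz homotopy group $\pi_1^{\mathrm{Lip}}(M,p_0)\subset\mathcal{P}_M$ is a metric. Moreover, if each point in $M$ supports only trivial local representation, then the lifted pseudo-metric $d_{\mathcal{P}}$ on the universal path space $\mathcal{P}_M$ is a metric.
   Context: All paths and loops are Lipschitz with domain $I=[0,1]$ (Euclidean metric); $\ell(\gamma)$ is the length of $\gamma$, $\overline{\gamma}$ the inverse path, $*$ concatenation. A metric space is Lipschitz path connected if any two points are joined by a Lipschitz path. $I\times I$ carries the $L^1$ metric. Two paths $\gamma,\gamma'$ in $M$ with the same initial points and the same end points are homotopic rel endpoints, $\gamma\simeq\gamma'$, if there is a Lipschitz map $H:I\times I\to M$ with $H|_{I\times\{0\}}=\gamma$, $H|_{I\times\{1\}}=\gamma'$, $H|_{\{0\}\times I}\equiv\gamma(0)$, $H|_{\{1\}\times I}\equiv\gamma(1)$; $[\gamma]$ denotes the class of $\gamma$. The first Lipschitz homotopy group $\pi_1^{\mathrm{Lip}}(M,p)$ is the set of classes of loops based at $p$ with group operation given by concatenation. The universal (Lipschitz) path space of $(M,p_0)$ is $\mathcal{P}_M=\{[\gamma] : \gamma:I\to M \text{ Lipschitz},\ \gamma(0)=p_0\}$, with base point $[p_0]$ (the class of the constant loop) and lifted pseudo-metric $d_{\mathcal{P}}([\gamma_1],[\gamma_2])=\inf\{\ell(\beta):\beta\simeq\overline{\gamma_1}*\gamma_2\}$.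 For $p\in M$, a class $[\alpha]\in\pi_1^{\mathrm{Lip}}(M,p)$ is locally representable if for every neighborhood $U\subset M$ of $p$ there is a representative $\alpha_U\in[\alpha]$ with image contained in $U$. The point $p$ supports only trivial local representation if the only locally representable class in $\pi_1^{\mathrm{Lip}}(M,p)$ is the trivial class $[p]$. *)

theory Defs
  imports "HOL-Analysis.Analysis"
begin

text \<open>
  The metric space \<open>M\<close> is a subset of a type of class \<open>metric_space\<close>, with the induced metric.
  As in the library, a path is a function on \<open>real\<close> of which only the restriction to
  \<open>{0..1}\<close> is relevant.
\<close>

definition lip_path :: "'a::metric_space set \<Rightarrow> (real \<Rightarrow> 'a) \<Rightarrow> bool" where
  "lip_path M \<gamma> \<longleftrightarrow> (\<exists>L. L-lipschitz_on {0..1} \<gamma>) \<and> path_image \<gamma> \<subseteq> M"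

definition lip_path_connected :: "'a::metric_space set \<Rightarrow> bool" where
  "lip_path_connected M \<longleftrightarrow>
     (\<forall>x\<in>M. \<forall>y\<in>M. \<exists>\<gamma>. lip_path M \<gamma> \<and> pathstart \<gamma> = x \<and> pathfinish \<gamma> = y)"

text \<open>
  For a Lipschitz path the set of sums is nonempty and bounded above (lemma below), so that the
  real supremum is the genuine one.
\<close>

definition path_sums :: "(real \<Rightarrow> 'a::metric_space) \<Rightarrow> real set" where
  "path_sums \<gamma> = {(\<Sum>i<n. dist (\<gamma> (t i)) (\<gamma> (t (Suc i)))) |n t.
     t 0 = (0::real) \<and> t n = 1 \<and> (\<forall>i<n. t i \<le> t (Suc i))}"

definition path_length :: "(real \<Rightarrow> 'a::metric_space) \<Rightarrow> real" where
  "path_length \<gamma> = Sup (path_sums \<gamma>)"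

lemma path_sums_nonempty: "path_sums \<gamma> \<noteq> {}"
proof -
  have "(\<Sum>i<(1::nat). dist (\<gamma> (real i)) (\<gamma> (real (Suc i)))) \<in> path_sums \<gamma>"
    unfolding path_sums_def by (intro CollectI exI[of _ "1::nat"] exI[of _ real]) simp
  then show ?thesis by blast
qed

lemma path_sums_bdd_above:
  assumes "L-lipschitz_on {0..1} \<gamma>"
  shows "bdd_above (path_sums \<gamma>)"
proof (rule bdd_aboveI)
  fix s assume "s \<in> path_sums \<gamma>"
  then obtain n t where s: "s = (\<Sum>i<n. dist (\<gamma> (t i)) (\<gamma> (t (Suc i))))"
    and t: "t 0 = (0::real)" "t n = 1" "\<forall>i<n. t i \<le> t (Suc i)"
    unfolding path_sums_def by blast
  have lo: "0 \<le> t i" if "i \<le> n" for i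
    using that t by (induction i) (auto intro: order_trans)
  have hi: "t i \<le> 1" if "i \<le> n" for i
    using that by (induction rule: inc_induct) (use t in \<open>auto intro: order_trans\<close>)
  have "s \<le> (\<Sum>i<n. L * (t (Suc i) - t i))"
    unfolding s
  proof (rule sum_mono)
    fix i assume "i \<in> {..<n}"
    then have "dist (\<gamma> (t i)) (\<gamma> (t (Suc i))) \<le> L * dist (t i) (t (Suc i))"
      using lo hi by (intro lipschitz_onD[OF assms]) auto
    then show "dist (\<gamma> (t i)) (\<gamma> (t (Suc i))) \<le> L * (t (Suc i) - t i)"
      using t(3) \<open>i \<in> {..<n}\<close> by (simp add: dist_real_def)
  qed
  also have "\<dots> = L"
    using t(1,2) by (simp add: sum_distrib_left[symmetric] sum_lessThan_telescope)
  finally show "s \<le> L" .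
qed

text \<open>
  The Lipschitz condition on the homotopy is spelled out because the metric of the library on
  pairs is the Euclidean one, not the \<open>L\<^sup>1\<close> metric.
\<close>

definition lip_homotopic :: "'a::metric_space set \<Rightarrow> (real \<Rightarrow> 'a) \<Rightarrow> (real \<Rightarrow> 'a) \<Rightarrow> bool" where
  "lip_homotopic M \<gamma> \<gamma>' \<longleftrightarrow>
     lip_path M \<gamma> \<and> lip_path M \<gamma>' \<and>
     pathstart \<gamma> = pathstart \<gamma>' \<and> pathfinish \<gamma> = pathfinish \<gamma>' \<and>
     (\<exists>H :: real \<times> real \<Rightarrow> 'a.
        (\<exists>L. \<forall>s\<in>{0..1}. \<forall>t\<in>{0..1}. \<forall>s'\<in>{0..1}. \<forall>t'\<in>{0..1}.
           dist (H (s, t)) (H (s', t')) \<le> L * (\<bar>s - s'\<bar> + \<bar>t - t'\<bar>)) \<and>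
        H ` ({0..1} \<times> {0..1}) \<subseteq> M \<and>
        (\<forall>s\<in>{0..1}. H (s, 0) = \<gamma> s) \<and>
        (\<forall>s\<in>{0..1}. H (s, 1) = \<gamma>' s) \<and>
        (\<forall>t\<in>{0..1}. H (0, t) = \<gamma> 0) \<and>
        (\<forall>t\<in>{0..1}. H (1, t) = \<gamma> 1))"

definition lip_class :: "'a::metric_space set \<Rightarrow> (real \<Rightarrow> 'a) \<Rightarrow> (real \<Rightarrow> 'a) set" where
  "lip_class M \<gamma> = {\<gamma>'. lip_homotopic M \<gamma> \<gamma>'}"

text \<open>The underlying set of the first Lipschitz homotopy group.\<close>

definition lip_pi1 :: "'a::metric_space set \<Rightarrow> 'a \<Rightarrow> (real \<Rightarrow> 'a) set set" where
  "lip_pi1 M p = {lip_class M \<gamma> |\<gamma>. lip_path M \<gamma> \<and> pathstart \<gamma> = p \<and> pathfinish \<gamma> = p}"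

definition lip_path_space :: "'a::metric_space set \<Rightarrow> 'a \<Rightarrow> (real \<Rightarrow> 'a) set set" where
  "lip_path_space M p0 = {lip_class M \<gamma> |\<gamma>. lip_path M \<gamma> \<and> pathstart \<gamma> = p0}"

lemma lip_pi1_subset_path_space: "lip_pi1 M p0 \<subseteq> lip_path_space M p0"
  unfolding lip_pi1_def lip_path_space_def by blast

text \<open>
  The infimum runs over all representatives of both classes; up to homotopy the concatenation does
  not depend on their choice. The value \<open>0\<close> off the path space is a convention: the locale
  \<open>Metric_space\<close> asks for nonnegativity and symmetry on the whole type.
\<close>

definition lifted_dist ::
    "'a::metric_space set \<Rightarrow> 'a \<Rightarrow> (real \<Rightarrow> 'a) set \<Rightarrow> (real \<Rightarrow> 'a) set \<Rightarrow> real" where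
  "lifted_dist M p0 A B =
     (if A \<in> lip_path_space M p0 \<and> B \<in> lip_path_space M p0
      then Inf {path_length \<beta> |\<beta> \<gamma>1 \<gamma>2.
             \<gamma>1 \<in> A \<and> \<gamma>2 \<in> B \<and> lip_homotopic M \<beta> (reversepath \<gamma>1 +++ \<gamma>2)}
      else 0)"

definition locally_representable ::
    "'a::metric_space set \<Rightarrow> 'a \<Rightarrow> (real \<Rightarrow> 'a) set \<Rightarrow> bool" where
  "locally_representable M p A \<longleftrightarrow>
     (\<forall>U. U \<subseteq> M \<and> (\<exists>V. openin (top_of_set M) V \<and> p \<in> V \<and> V \<subseteq> U)
        \<longrightarrow> (\<exists>\<alpha>\<in>A. path_image \<alpha> \<subseteq> U))"

definition only_trivial_local_rep :: "'a::metric_space set \<Rightarrow> 'a \<Rightarrow> bool" where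
  "only_trivial_local_rep M p \<longleftrightarrow>
     {A \<in> lip_pi1 M p. locally_representable M p A} = {lip_class M (\<lambda>_. p)}"

end

theory Submission
  imports Defs
begin

text \<open>
  Symmetry and the triangle inequality of \<open>lifted_dist\<close> come from reversing and concatenating the
  connecting paths \<open>\<beta> \<simeq> \<gamma>\<^sub>1\<inverse> * \<gamma>\<^sub>2\<close>, from
  \<open>(\<gamma>\<^sub>1\<inverse> * \<gamma>\<^sub>2) * (\<gamma>\<^sub>2\<inverse> * \<gamma>\<^sub>3) \<simeq> \<gamma>\<^sub>1\<inverse> * \<gamma>\<^sub>3\<close> (\<open>lip_homotopic_cancel_middle\<close>), and from the
  subadditivity of length (\<open>path_length_joinpaths_le\<close>). The point is that distance \<open>0\<close> forces
  equality of the classes.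

  Suppose \<open>[\<gamma>\<^sub>1]\<close> and \<open>[\<gamma>\<^sub>2]\<close> have lifted distance \<open>0\<close>. Then the class of \<open>\<gamma>\<^sub>1\<inverse> * \<gamma>\<^sub>2\<close> contains paths
  of arbitrarily small length. A path is at least as long as the distance of its end points, so
  \<open>\<gamma>\<^sub>1\<close> and \<open>\<gamma>\<^sub>2\<close> have the same end point \<open>p\<close>, and a loop at \<open>p\<close> of length less than \<open>e\<close> stays in the
  ball of radius \<open>e\<close> about \<open>p\<close>. Hence the class of the loop \<open>\<gamma>\<^sub>1\<inverse> * \<gamma>\<^sub>2\<close> is locally representable at
  \<open>p\<close>, so it is trivial when \<open>p\<close> supports only trivial local representation, and then \<open>\<gamma>\<^sub>1 \<simeq> \<gamma>\<^sub>2\<close>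
  (\<open>lip_homotopic_if_null\<close>). For the fundamental group the end point \<open>p\<close> is always the base point,
  so there the hypothesis at the base point is enough (\<open>lifted_dist_zero_imp_eq\<close>).

  Every homotopy that occurs is obtained by precomposing paths or homotopies with piecewise
  polynomial maps of the square. Such maps are Lipschitz by a few closure properties together with
  a gluing lemma: on a convex set, being Lipschitz can be checked on the two members of a closed
  cover.
\<close>

section \<open>Lipschitz functions with unspecified constant\<close>

definition is_lipschitz_on :: "'a::metric_space set \<Rightarrow> ('a \<Rightarrow> 'b::metric_space) \<Rightarrow> bool" where
  "is_lipschitz_on X f \<longleftrightarrow> (\<exists>L. L-lipschitz_on X f)"

lemma is_lipschitz_on_const: "is_lipschitz_on X (\<lambda>_. c)"
  unfolding is_lipschitz_on_def using lipschitz_on_constant by blast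

lemma is_lipschitz_on_id: "is_lipschitz_on X (\<lambda>x. x)"
  unfolding is_lipschitz_on_def using lipschitz_on_id by blast

lemma is_lipschitz_on_fst: "is_lipschitz_on X fst"
  unfolding is_lipschitz_on_def
  by (intro exI[of _ 1] lipschitz_onI) (auto simp: dist_fst_le)

lemma is_lipschitz_on_snd: "is_lipschitz_on X snd"
  unfolding is_lipschitz_on_def
  by (intro exI[of _ 1] lipschitz_onI) (auto simp: dist_snd_le)

lemma is_lipschitz_on_Pair:
  "is_lipschitz_on X f \<Longrightarrow> is_lipschitz_on X g \<Longrightarrow> is_lipschitz_on X (\<lambda>x. (f x, g x))"
  unfolding is_lipschitz_on_def using lipschitz_on_Pair by blast

lemma is_lipschitz_on_add:
  fixes f g :: "'a::metric_space \<Rightarrow> real"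
  shows "is_lipschitz_on X f \<Longrightarrow> is_lipschitz_on X g \<Longrightarrow> is_lipschitz_on X (\<lambda>x. f x + g x)"
  unfolding is_lipschitz_on_def using lipschitz_on_add by blast

lemma is_lipschitz_on_diff:
  fixes f g :: "'a::metric_space \<Rightarrow> real"
  shows "is_lipschitz_on X f \<Longrightarrow> is_lipschitz_on X g \<Longrightarrow> is_lipschitz_on X (\<lambda>x. f x - g x)"
  unfolding is_lipschitz_on_def using lipschitz_on_diff by blast

lemma is_lipschitz_on_cmult:
  fixes f :: "'a::metric_space \<Rightarrow> real"
  shows "is_lipschitz_on X f \<Longrightarrow> is_lipschitz_on X (\<lambda>x. c * f x)"
  unfolding is_lipschitz_on_def using lipschitz_on_cmult_real by blast

lemma is_lipschitz_on_divide:
  fixes f :: "'a::metric_space \<Rightarrow> real"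
  shows "is_lipschitz_on X f \<Longrightarrow> is_lipschitz_on X (\<lambda>x. f x / c)"
  using is_lipschitz_on_cmult[of X f "inverse c"] by (simp add: divide_inverse mult.commute)

lemma is_lipschitz_on_cong:
  "(\<And>x. x \<in> X \<Longrightarrow> f x = g x) \<Longrightarrow> is_lipschitz_on X f \<longleftrightarrow> is_lipschitz_on X g"
  unfolding is_lipschitz_on_def lipschitz_on_def by simp

lemma is_lipschitz_on_compose:
  assumes "is_lipschitz_on Y g" "is_lipschitz_on X f" "f ` X \<subseteq> Y"
  shows "is_lipschitz_on X (\<lambda>x. g (f x))"
proof -
  obtain C D where "C-lipschitz_on X f" "D-lipschitz_on Y g"
    using assms unfolding is_lipschitz_on_def by blast
  then have "(D * C)-lipschitz_on X (\<lambda>x. g (f x))"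
    using assms(3) by (intro lipschitz_on_compose2[OF _ lipschitz_on_subset])
  then show ?thesis unfolding is_lipschitz_on_def by blast
qed

lemma is_lipschitz_on_abs:
  fixes f :: "'a::metric_space \<Rightarrow> real"
  assumes "is_lipschitz_on X f"
  shows "is_lipschitz_on X (\<lambda>x. \<bar>f x\<bar>)"
proof -
  have "1-lipschitz_on UNIV (abs :: real \<Rightarrow> real)"
    by (intro lipschitz_onI) (auto simp: dist_real_def)
  then have "is_lipschitz_on UNIV (abs :: real \<Rightarrow> real)"
    unfolding is_lipschitz_on_def by blast
  from is_lipschitz_on_compose[OF this assms] show ?thesis by simp
qed

lemma is_lipschitz_on_max:
  fixes f g :: "'a::metric_space \<Rightarrow> real"
  assumes "is_lipschitz_on X f" "is_lipschitz_on X g"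
  shows "is_lipschitz_on X (\<lambda>x. max (f x) (g x))"
proof -
  have "(\<lambda>x. max (f x) (g x)) = (\<lambda>x. (f x + g x + \<bar>f x - g x\<bar>) / 2)"
    by (auto simp: fun_eq_iff max_def)
  then show ?thesis
    using assms by (auto intro!: is_lipschitz_on_divide is_lipschitz_on_add is_lipschitz_on_abs
        is_lipschitz_on_diff)
qed

lemma is_lipschitz_on_min:
  fixes f g :: "'a::metric_space \<Rightarrow> real"
  assumes "is_lipschitz_on X f" "is_lipschitz_on X g"
  shows "is_lipschitz_on X (\<lambda>x. min (f x) (g x))"
proof -
  have "(\<lambda>x. min (f x) (g x)) = (\<lambda>x. (f x + g x - \<bar>f x - g x\<bar>) / 2)"
    by (auto simp: fun_eq_iff min_def)
  then show ?thesis
    using assms by (auto intro!: is_lipschitz_on_divide is_lipschitz_on_add is_lipschitz_on_abs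
        is_lipschitz_on_diff)
qed

lemma is_lipschitz_on_mult:
  fixes f g :: "'a::metric_space \<Rightarrow> real"
  assumes "is_lipschitz_on X f" "is_lipschitz_on X g"
    and bd: "\<And>x. x \<in> X \<Longrightarrow> \<bar>f x\<bar> \<le> B" "\<And>x. x \<in> X \<Longrightarrow> \<bar>g x\<bar> \<le> B"
  shows "is_lipschitz_on X (\<lambda>x. f x * g x)"
proof -
  obtain C D where C: "C-lipschitz_on X f" and D: "D-lipschitz_on X g"
    using assms unfolding is_lipschitz_on_def by blast
  have nn: "0 \<le> C" "0 \<le> D" using C D lipschitz_on_nonneg by auto
  have "(\<bar>B\<bar> * D + \<bar>B\<bar> * C)-lipschitz_on X (\<lambda>x. f x * g x)"
  proof (rule lipschitz_onI)
    fix x y assume xy: "x \<in> X" "y \<in> X"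
    have "f x * g x - f y * g y = f x * (g x - g y) + g y * (f x - f y)"
      by (simp add: algebra_simps)
    then have "\<bar>f x * g x - f y * g y\<bar> \<le> \<bar>f x\<bar> * \<bar>g x - g y\<bar> + \<bar>g y\<bar> * \<bar>f x - f y\<bar>"
      by (metis abs_mult abs_triangle_ineq)
    also have "\<dots> \<le> \<bar>B\<bar> * (D * dist x y) + \<bar>B\<bar> * (C * dist x y)"
      using bd[OF xy(1)] bd[OF xy(2)] lipschitz_onD[OF C xy] lipschitz_onD[OF D xy]
      by (intro add_mono mult_mono) (auto simp: dist_real_def)
    finally show "dist (f x * g x) (f y * g y) \<le> (\<bar>B\<bar> * D + \<bar>B\<bar> * C) * dist x y"
      by (simp add: dist_real_def algebra_simps)
  qed (use nn in simp)
  then show ?thesis unfolding is_lipschitz_on_def by blast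
qed

lemmas is_lipschitz_intros =
  is_lipschitz_on_const is_lipschitz_on_id is_lipschitz_on_fst is_lipschitz_on_snd
  is_lipschitz_on_Pair is_lipschitz_on_add is_lipschitz_on_diff is_lipschitz_on_cmult
  is_lipschitz_on_divide is_lipschitz_on_abs is_lipschitz_on_max is_lipschitz_on_min

text \<open>
  A segment between two points of \<open>X\<close> is cut by the closed cover into closed pieces on each of
  which \<open>f\<close> is Lipschitz, so the statement reduces to the one on a real interval.
\<close>

lemma is_lipschitz_on_closed_cover:
  fixes f :: "'a::real_normed_vector \<Rightarrow> 'b::metric_space"
  assumes "convex X" "closed A" "closed B" "X \<subseteq> A \<union> B"
    and "is_lipschitz_on (X \<inter> A) f" "is_lipschitz_on (X \<inter> B) f"
  shows "is_lipschitz_on X f"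
proof -
  obtain C D where C: "C-lipschitz_on (X \<inter> A) f" and D: "D-lipschitz_on (X \<inter> B) f"
    using assms unfolding is_lipschitz_on_def by blast
  define L where "L = max C D"
  have L: "L-lipschitz_on (X \<inter> Y) f" if "Y \<in> {A, B}" for Y
    using that C D lipschitz_on_le unfolding L_def by (metis insertE max.cobounded1 max.cobounded2 singletonD)
  have L0: "0 \<le> L" using C lipschitz_on_nonneg unfolding L_def by fastforce
  have "L-lipschitz_on X f"
  proof (rule lipschitz_onI)
    fix x y assume xy: "x \<in> X" "y \<in> X"
    define c where "c u = (1 - u) *\<^sub>R x + u *\<^sub>R y" for u
    have cX: "c u \<in> X" if "u \<in> {0..1}" for u
      unfolding c_def using that xy \<open>convex X\<close> by (auto simp: convex_alt)
    have cd: "dist (c u) (c v) = \<bar>u - v\<bar> * dist x y" for u v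
    proof -
      have "c u - c v = (v - u) *\<^sub>R (x - y)" unfolding c_def by (simp add: algebra_simps)
      then show ?thesis by (simp add: dist_norm abs_minus_commute)
    qed
    have cc: "continuous_on {0..1} c" unfolding c_def by (intro continuous_intros)
    have "(L * dist x y)-lipschitz_on {0..1::real} (\<lambda>u. f (c u))"
    proof (rule lipschitz_on_closed_Union[where I = "{A, B}" and U = "\<lambda>Y. {u \<in> {0..1}. c u \<in> Y}"])
      fix Y assume Y: "Y \<in> {A, B}"
      then have "closed Y" using assms by auto
      then have "closed ({0..1} \<inter> c -` Y)"
        using cc by (intro continuous_closed_preimage) auto
      then show "closed {u \<in> {0..1}. c u \<in> Y}"
        by (simp only: vimage_def Int_def mem_Collect_eq)
      show "(L * dist x y)-lipschitz_on {u \<in> {0..1}. c u \<in> Y} (\<lambda>u. f (c u))"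
      proof (rule lipschitz_onI)
        fix u v assume "u \<in> {u \<in> {0..1}. c u \<in> Y}" "v \<in> {u \<in> {0..1}. c u \<in> Y}"
        then have "dist (f (c u)) (f (c v)) \<le> L * dist (c u) (c v)"
          using cX by (intro lipschitz_onD[OF L[OF Y]]) auto
        then show "dist (f (c u)) (f (c v)) \<le> L * dist x y * dist u v"
          by (simp add: cd dist_real_def mult.commute mult.left_commute)
      qed (use L0 in simp)
    next
      show "{0..1} \<subseteq> (\<Union>Y\<in>{A, B}. {u \<in> {0..1}. c u \<in> Y})"
        using subsetD[OF \<open>X \<subseteq> A \<union> B\<close> cX] by blast
    qed (use L0 in auto)
    from lipschitz_onD[OF this, of 0 1]
    show "dist (f x) (f y) \<le> L * dist x y" by (simp add: c_def)
  qed (rule L0)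
  then show ?thesis unfolding is_lipschitz_on_def by blast
qed

lemma is_lipschitz_on_If_le:
  fixes h :: "'a::real_normed_vector \<Rightarrow> real" and f g :: "'a \<Rightarrow> 'b::metric_space"
  assumes "convex X" and h: "continuous_on UNIV h"
    and f: "is_lipschitz_on {x \<in> X. h x \<le> c} f" and g: "is_lipschitz_on {x \<in> X. c \<le> h x} g"
    and eq: "\<And>x. x \<in> X \<Longrightarrow> h x = c \<Longrightarrow> f x = g x"
  shows "is_lipschitz_on X (\<lambda>x. if h x \<le> c then f x else g x)" (is "is_lipschitz_on X ?k")
proof (rule is_lipschitz_on_closed_cover[where A = "{x. h x \<le> c}" and B = "{x. c \<le> h x}"])
  show "closed {x. h x \<le> c}" "closed {x. c \<le> h x}"
    using h by (auto intro: closed_Collect_le continuous_on_const)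
  have "is_lipschitz_on {x \<in> X. h x \<le> c} ?k"
    using f is_lipschitz_on_cong[of "{x \<in> X. h x \<le> c}" ?k f] by simp
  then show "is_lipschitz_on (X \<inter> {x. h x \<le> c}) ?k" by (simp add: Int_def)
  have "is_lipschitz_on {x \<in> X. c \<le> h x} ?k"
    using g eq is_lipschitz_on_cong[of "{x \<in> X. c \<le> h x}" ?k g] by force
  then show "is_lipschitz_on (X \<inter> {x. c \<le> h x}) ?k" by (simp add: Int_def)
qed (use assms in auto)

section \<open>Homotopies of Lipschitz paths\<close>

lemma lip_path_iff: "lip_path M \<gamma> \<longleftrightarrow> is_lipschitz_on {0..1} \<gamma> \<and> (\<forall>s\<in>{0..1}. \<gamma> s \<in> M)"
  unfolding lip_path_def is_lipschitz_on_def path_image_def by auto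

abbreviation unit_square :: "(real \<times> real) set" where
  "unit_square \<equiv> {0..1} \<times> {0..1}"

lemma convex_unit_square: "convex unit_square"
  by (intro convex_Times) auto

text \<open>
  The \<open>L\<^sup>1\<close> and the Euclidean metric on the square are equivalent; with the latter the calculus
  above applies.
\<close>

lemma is_lipschitz_on_unit_square_iff:
  "is_lipschitz_on unit_square H \<longleftrightarrow>
    (\<exists>L. \<forall>s\<in>{0..1}. \<forall>t\<in>{0..1}. \<forall>s'\<in>{0..1}. \<forall>t'\<in>{0..1}.
           dist (H (s, t)) (H (s', t')) \<le> L * (\<bar>s - s'\<bar> + \<bar>t - t'\<bar>))"  (is "_ \<longleftrightarrow> (\<exists>L. ?P L)")
proof
  assume "is_lipschitz_on unit_square H"
  then obtain L where L: "L-lipschitz_on unit_square H"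
    unfolding is_lipschitz_on_def by blast
  have "?P L"
  proof (intro ballI)
    fix s t s' t' :: real
    assume "s \<in> {0..1}" "t \<in> {0..1}" "s' \<in> {0..1}" "t' \<in> {0..1}"
    then have "dist (H (s, t)) (H (s', t')) \<le> L * dist (s, t) (s', t')"
      by (intro lipschitz_onD[OF L]) auto
    also have "dist (s, t) (s', t') \<le> \<bar>s - s'\<bar> + \<bar>t - t'\<bar>"
      by (simp add: dist_Pair_Pair dist_real_def sqrt_sum_squares_le_sum_abs)
    finally show "dist (H (s, t)) (H (s', t')) \<le> L * (\<bar>s - s'\<bar> + \<bar>t - t'\<bar>)"
      using lipschitz_on_nonneg[OF L] by (simp add: mult_left_mono)
  qed
  then show "\<exists>L. ?P L" ..
next
  assume "\<exists>L. ?P L"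
  then obtain L where L: "?P L" ..
  have "(2 * \<bar>L\<bar>)-lipschitz_on unit_square H"
  proof (rule lipschitz_onI)
    fix z w assume zw: "z \<in> unit_square" "w \<in> unit_square"
    obtain s t s' t' where e: "z = (s, t)" "w = (s', t')" by (metis surj_pair)
    have "dist (H z) (H w) \<le> L * (\<bar>s - s'\<bar> + \<bar>t - t'\<bar>)" using L zw e by auto
    also have "\<dots> \<le> \<bar>L\<bar> * (\<bar>s - s'\<bar> + \<bar>t - t'\<bar>)" by (intro mult_right_mono) auto
    also have "\<dots> \<le> \<bar>L\<bar> * (dist z w + dist z w)"
      using dist_fst_le[of z w] dist_snd_le[of z w] e
      by (intro mult_left_mono add_mono) (auto simp: dist_real_def)
    finally show "dist (H z) (H w) \<le> 2 * \<bar>L\<bar> * dist z w" by simp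
  qed simp
  then show "is_lipschitz_on unit_square H" unfolding is_lipschitz_on_def by blast
qed

lemma lip_homotopicI:
  assumes H: "is_lipschitz_on unit_square H" "\<And>s t. s \<in> {0..1} \<Longrightarrow> t \<in> {0..1} \<Longrightarrow> H (s, t) \<in> M"
    and bot: "\<And>s. s \<in> {0..1} \<Longrightarrow> H (s, 0) = \<gamma> s" and top: "\<And>s. s \<in> {0..1} \<Longrightarrow> H (s, 1) = \<gamma>' s"
    and left: "\<And>t. t \<in> {0..1} \<Longrightarrow> H (0, t) = \<gamma> 0" and right: "\<And>t. t \<in> {0..1} \<Longrightarrow> H (1, t) = \<gamma> 1"
  shows "lip_homotopic M \<gamma> \<gamma>'"
proof -
  have side: "is_lipschitz_on {0..1} (\<lambda>s. H (s, c))" if "c \<in> {0..1}" for c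
    using that by (intro is_lipschitz_on_compose[OF H(1)] is_lipschitz_intros) auto
  have "is_lipschitz_on {0..1} \<gamma>" "is_lipschitz_on {0..1} \<gamma>'"
    using side[of 0] side[of 1] bot top is_lipschitz_on_cong[of "{0..1}" "\<lambda>s. H (s, 0)" \<gamma>]
      is_lipschitz_on_cong[of "{0..1}" "\<lambda>s. H (s, 1)" \<gamma>'] by auto
  moreover have "\<gamma> s \<in> M" "\<gamma>' s \<in> M" if "s \<in> {0..1}" for s
    using H(2)[OF that, of 0] H(2)[OF that, of 1] bot top that by auto
  ultimately have "lip_path M \<gamma>" "lip_path M \<gamma>'" by (auto simp: lip_path_iff)
  moreover have "\<gamma>' 0 = \<gamma> 0" "\<gamma>' 1 = \<gamma> 1"
    using top[of 0] left[of 1] top[of 1] right[of 1] by auto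
  moreover have "H ` unit_square \<subseteq> M" using H(2) by auto
  ultimately show ?thesis
    unfolding lip_homotopic_def is_lipschitz_on_unit_square_iff[symmetric]
      pathstart_def pathfinish_def
    using H(1) bot top left right by (intro conjI exI[of _ H]) auto
qed

definition lip_homotopy ::
    "'a::metric_space set \<Rightarrow> (real \<Rightarrow> 'a) \<Rightarrow> (real \<Rightarrow> 'a) \<Rightarrow> (real \<times> real \<Rightarrow> 'a) \<Rightarrow> bool" where
  "lip_homotopy M \<gamma> \<gamma>' H \<longleftrightarrow>
     is_lipschitz_on unit_square H \<and> H ` unit_square \<subseteq> M \<and>
     (\<forall>s\<in>{0..1}. H (s, 0) = \<gamma> s) \<and> (\<forall>s\<in>{0..1}. H (s, 1) = \<gamma>' s) \<and>
     (\<forall>t\<in>{0..1}. H (0, t) = \<gamma> 0) \<and> (\<forall>t\<in>{0..1}. H (1, t) = \<gamma> 1) \<and>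
     \<gamma> 0 = \<gamma>' 0 \<and> \<gamma> 1 = \<gamma>' 1"

lemma lip_homotopyD:
  assumes "lip_homotopy M \<gamma> \<gamma>' H"
  shows "is_lipschitz_on unit_square H"
    "\<And>s t. s \<in> {0..1} \<Longrightarrow> t \<in> {0..1} \<Longrightarrow> H (s, t) \<in> M"
    "\<And>s. s \<in> {0..1} \<Longrightarrow> H (s, 0) = \<gamma> s" "\<And>s. s \<in> {0..1} \<Longrightarrow> H (s, 1) = \<gamma>' s"
    "\<And>t. t \<in> {0..1} \<Longrightarrow> H (0, t) = \<gamma> 0" "\<And>t. t \<in> {0..1} \<Longrightarrow> H (1, t) = \<gamma> 1"
    "\<gamma> 0 = \<gamma>' 0" "\<gamma> 1 = \<gamma>' 1"
  using assms unfolding lip_homotopy_def image_subset_iff by blast+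

lemma lip_homotopicE:
  assumes "lip_homotopic M \<gamma> \<gamma>'"
  obtains H where "lip_homotopy M \<gamma> \<gamma>' H"
  using assms
  unfolding lip_homotopic_def is_lipschitz_on_unit_square_iff[symmetric] lip_homotopy_def
    pathstart_def pathfinish_def by blast

lemma lip_homotopicD:
  assumes "lip_homotopic M \<gamma> \<gamma>'"
  shows "lip_path M \<gamma>" "lip_path M \<gamma>'"
    "pathstart \<gamma> = pathstart \<gamma>'" "pathfinish \<gamma> = pathfinish \<gamma>'"
  using assms unfolding lip_homotopic_def by blast+

lemma lip_path_reversepath:
  assumes "lip_path M \<gamma>"
  shows "lip_path M (reversepath \<gamma>)"
proof -
  have lip: "is_lipschitz_on {0..1} \<gamma>" using assms by (simp add: lip_path_iff)
  have "is_lipschitz_on {0..1} (\<lambda>s. \<gamma> (1 - s))"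
    by (intro is_lipschitz_on_compose[OF lip] is_lipschitz_intros) auto
  then show ?thesis using assms by (auto simp: lip_path_iff reversepath_def)
qed

lemma lip_path_joinpaths:
  assumes "lip_path M \<gamma>" "lip_path M \<delta>" "pathfinish \<gamma> = pathstart \<delta>"
  shows "lip_path M (\<gamma> +++ \<delta>)"
proof -
  have lip: "is_lipschitz_on {0..1} \<gamma>" "is_lipschitz_on {0..1} \<delta>"
    using assms by (auto simp: lip_path_iff)
  have "is_lipschitz_on {0..1} (\<gamma> +++ \<delta>)"
    unfolding joinpaths_def
    by (intro is_lipschitz_on_If_le continuous_intros is_lipschitz_on_compose[OF lip(1)]
        is_lipschitz_on_compose[OF lip(2)] is_lipschitz_intros)
      (use assms(3) in \<open>auto simp: pathfinish_def pathstart_def mult.commute[of 2]\<close>)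
  then show ?thesis using assms by (auto simp: lip_path_iff joinpaths_def)
qed

text \<open>
  The linear homotopy between two parameter changes stays in the domain of \<open>\<gamma>\<close>. As the parameter
  changes need not be monotone, this also contracts a path that is traversed back and forth.
\<close>

lemma lip_homotopic_reparam:
  assumes \<gamma>: "lip_path M \<gamma>"
    and \<phi>: "is_lipschitz_on {0..1} \<phi>" "\<phi> ` {0..1} \<subseteq> {0..1}"
    and \<psi>: "is_lipschitz_on {0..1} \<psi>" "\<psi> ` {0..1} \<subseteq> {0..1}"
    and ends: "\<phi> 0 = \<psi> 0" "\<phi> 1 = \<psi> 1"
  shows "lip_homotopic M (\<lambda>s. \<gamma> (\<phi> s)) (\<lambda>s. \<gamma> (\<psi> s))"
proof -
  have lip: "is_lipschitz_on {0..1} \<gamma>" using \<gamma> by (simp add: lip_path_iff)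
  define k where "k = (\<lambda>z::real \<times> real. (1 - snd z) * \<phi> (fst z) + snd z * \<psi> (fst z))"
  have range: "\<phi> s \<in> {0..1}" "\<psi> s \<in> {0..1}" if "s \<in> {0..1}" for s
    using \<phi>(2) \<psi>(2) that unfolding image_subset_iff by blast+
  have k01: "k (s, t) \<in> {0..1}" if "s \<in> {0..1}" "t \<in> {0..1}" for s t
    using convexD_alt[of "{0..1::real}" "\<phi> s" "\<psi> s" t] range[OF that(1)] that
    unfolding k_def by auto
  have bnd: "\<bar>\<phi> (fst z)\<bar> \<le> 1" "\<bar>\<psi> (fst z)\<bar> \<le> 1" if "z \<in> unit_square" for z
    using range[of "fst z"] that by (auto simp: mem_Times_iff)
  have "is_lipschitz_on unit_square (\<lambda>z. \<phi> (fst z))" "is_lipschitz_on unit_square (\<lambda>z. \<psi> (fst z))"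
    by (auto intro!: is_lipschitz_on_compose[OF \<phi>(1)] is_lipschitz_on_compose[OF \<psi>(1)]
        is_lipschitz_intros)
  then have "is_lipschitz_on unit_square k"
    unfolding k_def using bnd
    by (intro is_lipschitz_intros is_lipschitz_on_mult[where B = 1]) auto
  then have "is_lipschitz_on unit_square (\<lambda>z. \<gamma> (k z))"
    using k01 by (intro is_lipschitz_on_compose[OF lip]) auto
  then show ?thesis
  proof (rule lip_homotopicI)
    show "\<gamma> (k (s, t)) \<in> M" if "s \<in> {0..1}" "t \<in> {0..1}" for s t
      using \<gamma> k01[OF that] by (auto simp: lip_path_iff)
  qed (auto simp: k_def ends algebra_simps)
qed

lemma lip_homotopic_refl: "lip_path M \<gamma> \<Longrightarrow> lip_homotopic M \<gamma> \<gamma>"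
  using lip_homotopic_reparam[of M \<gamma> "\<lambda>s. s" "\<lambda>s. s"] by (auto intro: is_lipschitz_intros)

lemma lip_homotopic_sym:
  assumes "lip_homotopic M \<gamma> \<gamma>'"
  shows "lip_homotopic M \<gamma>' \<gamma>"
proof -
  obtain H where "lip_homotopy M \<gamma> \<gamma>' H"
    using assms by (rule lip_homotopicE)
  note H = lip_homotopyD[OF this]
  have "is_lipschitz_on unit_square (\<lambda>z. H (fst z, 1 - snd z))"
    by (intro is_lipschitz_on_compose[OF H(1)] is_lipschitz_intros) auto
  then show ?thesis by (rule lip_homotopicI) (auto simp: H)
qed

lemma lip_homotopic_trans:
  assumes "lip_homotopic M \<gamma>\<^sub>1 \<gamma>\<^sub>2" "lip_homotopic M \<gamma>\<^sub>2 \<gamma>\<^sub>3"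
  shows "lip_homotopic M \<gamma>\<^sub>1 \<gamma>\<^sub>3"
proof -
  obtain H where "lip_homotopy M \<gamma>\<^sub>1 \<gamma>\<^sub>2 H"
    using assms(1) by (rule lip_homotopicE)
  note H = lip_homotopyD[OF this]
  obtain K where "lip_homotopy M \<gamma>\<^sub>2 \<gamma>\<^sub>3 K"
    using assms(2) by (rule lip_homotopicE)
  note K = lip_homotopyD[OF this]
  have "is_lipschitz_on unit_square
      (\<lambda>z. if snd z \<le> 1/2 then H (fst z, 2 * snd z) else K (fst z, 2 * snd z - 1))"
    by (intro is_lipschitz_on_If_le convex_unit_square continuous_intros
        is_lipschitz_on_compose[OF H(1)] is_lipschitz_on_compose[OF K(1)] is_lipschitz_intros)
      (auto simp: H K mult.commute[of 2])
  then show ?thesis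
    by (rule lip_homotopicI) (auto simp: H K)
qed

lemma lip_homotopic_reversepath:
  assumes "lip_homotopic M \<gamma> \<gamma>'"
  shows "lip_homotopic M (reversepath \<gamma>) (reversepath \<gamma>')"
proof -
  obtain H where "lip_homotopy M \<gamma> \<gamma>' H"
    using assms by (rule lip_homotopicE)
  note H = lip_homotopyD[OF this]
  have "is_lipschitz_on unit_square (\<lambda>z. H (1 - fst z, snd z))"
    by (intro is_lipschitz_on_compose[OF H(1)] is_lipschitz_intros) auto
  then show ?thesis by (rule lip_homotopicI) (auto simp: H reversepath_def)
qed

lemma lip_homotopic_joinpaths:
  assumes "lip_homotopic M \<gamma> \<gamma>'" "lip_homotopic M \<delta> \<delta>'" "pathfinish \<gamma> = pathstart \<delta>"
  shows "lip_homotopic M (\<gamma> +++ \<delta>) (\<gamma>' +++ \<delta>')"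
proof -
  obtain H where "lip_homotopy M \<gamma> \<gamma>' H"
    using assms(1) by (rule lip_homotopicE)
  note H = lip_homotopyD[OF this]
  obtain K where "lip_homotopy M \<delta> \<delta>' K"
    using assms(2) by (rule lip_homotopicE)
  note K = lip_homotopyD[OF this]
  have mid: "\<gamma> 1 = \<delta> 0" using assms(3) by (simp add: pathfinish_def pathstart_def)
  have "is_lipschitz_on unit_square
      (\<lambda>z. if fst z \<le> 1/2 then H (2 * fst z, snd z) else K (2 * fst z - 1, snd z))"
    by (intro is_lipschitz_on_If_le convex_unit_square continuous_intros
        is_lipschitz_on_compose[OF H(1)] is_lipschitz_on_compose[OF K(1)] is_lipschitz_intros)
      (auto simp: H(3-6) K(3-6) mid mult.commute[of 2])
  then show ?thesis
    by (rule lip_homotopicI) (auto simp: H K joinpaths_def)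
qed

lemma lip_homotopic_const_reversepath_join:
  assumes "lip_path M \<gamma>"
  shows "lip_homotopic M (\<lambda>_. pathfinish \<gamma>) (reversepath \<gamma> +++ \<gamma>)"
proof -
  have "reversepath \<gamma> +++ \<gamma> = (\<lambda>s. \<gamma> \<bar>1 - 2 * s\<bar>)"
    by (auto simp: fun_eq_iff reversepath_def joinpaths_def)
  moreover have "lip_homotopic M (\<lambda>s. \<gamma> ((\<lambda>_. 1) s)) (\<lambda>s. \<gamma> \<bar>1 - 2 * s\<bar>)"
    by (intro lip_homotopic_reparam assms is_lipschitz_intros) auto
  ultimately show ?thesis by (simp add: pathfinish_def)
qed

text \<open>
  The middle part \<open>\<gamma>\<^sub>2 * \<gamma>\<^sub>2\<inverse>\<close> is retracted along \<open>\<gamma>\<^sub>2\<close> to the common initial point: at time \<open>t\<close> only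
  the restriction of \<open>\<gamma>\<^sub>2\<close> to \<open>[0, t]\<close> is traversed. At time \<open>0\<close> a parametrisation of
  \<open>\<gamma>\<^sub>1\<inverse> * \<gamma>\<^sub>3\<close> that rests during \<open>[1/4, 3/4]\<close> is left.
\<close>

lemma lip_homotopic_cancel_middle:
  assumes paths: "lip_path M \<gamma>\<^sub>1" "lip_path M \<gamma>\<^sub>2" "lip_path M \<gamma>\<^sub>3"
    and starts: "pathstart \<gamma>\<^sub>1 = p" "pathstart \<gamma>\<^sub>2 = p" "pathstart \<gamma>\<^sub>3 = p"
  shows "lip_homotopic M ((reversepath \<gamma>\<^sub>1 +++ \<gamma>\<^sub>2) +++ (reversepath \<gamma>\<^sub>2 +++ \<gamma>\<^sub>3))
    (reversepath \<gamma>\<^sub>1 +++ \<gamma>\<^sub>3)"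
proof -
  have zero: "\<gamma>\<^sub>1 0 = p" "\<gamma>\<^sub>2 0 = p" "\<gamma>\<^sub>3 0 = p" using starts by (auto simp: pathstart_def)
  define m where "m = (\<lambda>z::real \<times> real. snd z * (1 - \<bar>4 * fst z - 2\<bar>))"
  define H where "H = (\<lambda>z::real \<times> real. if fst z \<le> 1/4 then \<gamma>\<^sub>1 (1 - 4 * fst z)
      else if fst z \<le> 3/4 then \<gamma>\<^sub>2 (m z) else \<gamma>\<^sub>3 (4 * fst z - 3))"
  define \<phi> where "\<phi> = (\<lambda>s::real. min (2 * s) (max (1/2) (2 * s - 1)))"
  have m01: "m (s, t) \<in> {0..1}" if "s \<in> {1/4..3/4}" "t \<in> {0..1}" for s t
    using that unfolding m_def by (auto simp: abs_if intro!: mult_le_one)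
  have m_lip: "is_lipschitz_on X m" if "X \<subseteq> unit_square" for X
  proof -
    have "\<bar>snd z\<bar> \<le> 1" "\<bar>1 - \<bar>4 * fst z - 2\<bar>\<bar> \<le> 1" if "z \<in> X" for z
    proof -
      have "z \<in> unit_square" using \<open>X \<subseteq> unit_square\<close> that by blast
      then show "\<bar>snd z\<bar> \<le> 1" "\<bar>1 - \<bar>4 * fst z - 2\<bar>\<bar> \<le> 1"
        by (auto simp: abs_if mem_Times_iff)
    qed
    then show ?thesis unfolding m_def
      by (intro is_lipschitz_on_mult[where B = 1] is_lipschitz_intros) auto
  qed
  have lip: "is_lipschitz_on {0..1} \<gamma>\<^sub>1" "is_lipschitz_on {0..1} \<gamma>\<^sub>2" "is_lipschitz_on {0..1} \<gamma>\<^sub>3"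
    and inM: "\<And>s. s \<in> {0..1} \<Longrightarrow> \<gamma>\<^sub>1 s \<in> M" "\<And>s. s \<in> {0..1} \<Longrightarrow> \<gamma>\<^sub>2 s \<in> M"
      "\<And>s. s \<in> {0..1} \<Longrightarrow> \<gamma>\<^sub>3 s \<in> M"
    using paths by (auto simp: lip_path_iff)
  let ?R = "{z \<in> unit_square. 1/4 \<le> fst z}"
  have convR: "convex ?R"
  proof -
    have "?R = {1/4..1} \<times> {0..1}" by auto
    then show ?thesis by (simp add: convex_Times)
  qed
  have right: "is_lipschitz_on ?R (\<lambda>z. if fst z \<le> 3/4 then \<gamma>\<^sub>2 (m z) else \<gamma>\<^sub>3 (4 * fst z - 3))"
    using m01
    by (intro is_lipschitz_on_If_le convR continuous_intros
        is_lipschitz_on_compose[OF lip(2)] is_lipschitz_on_compose[OF lip(3)] m_lip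
        is_lipschitz_intros) (auto simp: zero m_def mult.commute[of 4])
  have "is_lipschitz_on unit_square H"
    unfolding H_def
    by (intro is_lipschitz_on_If_le[OF convex_unit_square _ _ right] continuous_intros
        is_lipschitz_on_compose[OF lip(1)] is_lipschitz_intros)
      (auto simp: zero m_def mult.commute[of 4])
  then have "is_lipschitz_on unit_square (\<lambda>z. H (fst z, 1 - snd z))"
    by (rule is_lipschitz_on_compose) (intro is_lipschitz_intros, auto)
  then have "lip_homotopic M ((reversepath \<gamma>\<^sub>1 +++ \<gamma>\<^sub>2) +++ (reversepath \<gamma>\<^sub>2 +++ \<gamma>\<^sub>3))
      (\<lambda>s. (reversepath \<gamma>\<^sub>1 +++ \<gamma>\<^sub>3) (\<phi> s))"
  proof (rule lip_homotopicI)
    show "H (fst (s, t), 1 - snd (s, t)) \<in> M" if "s \<in> {0..1}" "t \<in> {0..1}" for s t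
      using that m01 unfolding H_def by (auto intro!: inM)
    show "H (fst (s, 0), 1 - snd (s, 0))
        = ((reversepath \<gamma>\<^sub>1 +++ \<gamma>\<^sub>2) +++ reversepath \<gamma>\<^sub>2 +++ \<gamma>\<^sub>3) s" if "s \<in> {0..1}" for s
    proof (cases "s = 1/2")
      case True
      show ?thesis unfolding True by (simp add: H_def m_def joinpaths_def)
    next
      case False
      then show ?thesis
        by (auto simp: H_def m_def joinpaths_def reversepath_def algebra_simps abs_if)
    qed
    show "H (fst (s, 1), 1 - snd (s, 1)) = (reversepath \<gamma>\<^sub>1 +++ \<gamma>\<^sub>3) (\<phi> s)" if "s \<in> {0..1}" for s
    proof (cases "s = 3/4")
      case True
      show ?thesis unfolding True
        by (simp add: zero H_def m_def \<phi>_def joinpaths_def reversepath_def)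
    next
      case False
      then show ?thesis
        using zero by (auto simp: H_def m_def \<phi>_def joinpaths_def reversepath_def min_def max_def)
    qed
  qed (auto simp: H_def joinpaths_def reversepath_def)
  moreover have "lip_homotopic M (\<lambda>s. (reversepath \<gamma>\<^sub>1 +++ \<gamma>\<^sub>3) (\<phi> s))
      (\<lambda>s. (reversepath \<gamma>\<^sub>1 +++ \<gamma>\<^sub>3) ((\<lambda>s. s) s))"
    unfolding \<phi>_def
    by (intro lip_homotopic_reparam lip_path_joinpaths lip_path_reversepath paths
        is_lipschitz_intros) (use starts in auto)
  ultimately show ?thesis using lip_homotopic_trans by auto
qed

text \<open>
  Let \<open>H\<close> contract the loop \<open>\<gamma>\<^sub>1\<inverse> * \<gamma>\<^sub>2\<close> on the bottom side of the square; it is constant on the other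
  three sides. The two halves of the bottom side are segments from \<open>(1/2, 0)\<close> to the corners
  \<open>(0, 0)\<close> and \<open>(1, 0)\<close>, and \<open>H\<close> takes them to \<open>\<gamma>\<^sub>1\<close> and \<open>\<gamma>\<^sub>2\<close>. Moving the end point of the segment
  from one corner to the other along the three sides gives the homotopy from \<open>\<gamma>\<^sub>1\<close> to \<open>\<gamma>\<^sub>2\<close>.
\<close>

lemma lip_homotopic_if_null:
  assumes null: "lip_homotopic M (reversepath \<gamma>\<^sub>1 +++ \<gamma>\<^sub>2) (\<lambda>_. p)"
    and start: "pathstart \<gamma>\<^sub>1 = pathstart \<gamma>\<^sub>2"
  shows "lip_homotopic M \<gamma>\<^sub>1 \<gamma>\<^sub>2"
proof -
  let ?W = "reversepath \<gamma>\<^sub>1 +++ \<gamma>\<^sub>2"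
  obtain H where "lip_homotopy M ?W (\<lambda>_. p) H"
    using null by (rule lip_homotopicE)
  note H = lip_homotopyD[OF this]
  have zero: "\<gamma>\<^sub>1 0 = \<gamma>\<^sub>2 0" using start by (simp add: pathstart_def)
  have one: "\<gamma>\<^sub>1 1 = p" using H(7) by (simp add: joinpaths_def reversepath_def)
  \<comment> \<open>\<open>(x t, y t)\<close> walks up the left side, along the top and down the right side.\<close>
  define x y where "x t = min 1 (max 0 (3 * t - 1))" and "y t = min 1 (min (3 * t) (3 - 3 * t))"
    for t :: real
  define k where "k = (\<lambda>z::real \<times> real.
      ((1 - fst z) / 2 + fst z * x (snd z), fst z * y (snd z)))"
  have xy01: "x t \<in> {0..1}" "y t \<in> {0..1}" if "t \<in> {0..1}" for t
    using that by (auto simp: x_def y_def)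
  have k01: "k (s, t) \<in> unit_square" if st: "s \<in> {0..1}" "t \<in> {0..1}" for s t
  proof -
    have "(1 - s) *\<^sub>R (1/2) + s *\<^sub>R x t \<in> {0..1::real}"
      using st xy01[OF st(2)] by (intro convexD_alt) auto
    then show ?thesis
      using st xy01[OF st(2)] unfolding k_def by (auto intro!: mult_le_one)
  qed
  have bnd: "\<bar>fst z\<bar> \<le> 1" "\<bar>x (snd z)\<bar> \<le> 1" "\<bar>y (snd z)\<bar> \<le> 1" if "z \<in> unit_square" for z
    using that xy01[of "snd z"] by (auto simp: mem_Times_iff)
  have "is_lipschitz_on unit_square (\<lambda>z. x (snd z))" "is_lipschitz_on unit_square (\<lambda>z. y (snd z))"
    unfolding x_def y_def by (intro is_lipschitz_intros)+
  then have "is_lipschitz_on unit_square k"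
    unfolding k_def using bnd
    by (intro is_lipschitz_intros is_lipschitz_on_mult[where B = 1]) auto
  then have "is_lipschitz_on unit_square (\<lambda>z. H (k z))"
    using k01 by (intro is_lipschitz_on_compose[OF H(1)]) blast+
  then show ?thesis
  proof (rule lip_homotopicI)
    show "H (k (s, t)) \<in> M" if "s \<in> {0..1}" "t \<in> {0..1}" for s t
      using k01[OF that] H(2) by (cases "k (s, t)") auto
    show "H (k (s, 0)) = \<gamma>\<^sub>1 s" if "s \<in> {0..1}" for s
    proof -
      have "k (s, 0) = ((1 - s) / 2, 0)" by (simp add: k_def x_def y_def)
      then show ?thesis using that H(3)[of "(1 - s) / 2"]
        by (auto simp: joinpaths_def reversepath_def diff_divide_distrib)
    qed
    show "H (k (s, 1)) = \<gamma>\<^sub>2 s" if "s \<in> {0..1}" for s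
    proof -
      have "k (s, 1) = ((1 + s) / 2, 0)" by (simp add: k_def x_def y_def field_simps)
      then show ?thesis using that H(3)[of "(1 + s) / 2"] zero
        by (auto simp: joinpaths_def reversepath_def field_simps)
    qed
    show "H (k (0, t)) = \<gamma>\<^sub>1 0" if "t \<in> {0..1}" for t
      using H(3)[of "1/2"] by (simp add: k_def joinpaths_def reversepath_def)
    show "H (k (1, t)) = \<gamma>\<^sub>1 1" if t: "t \<in> {0..1}" for t
    proof -
      have "x t = 0 \<or> y t = 1 \<or> x t = 1"
      proof -
        consider "t \<le> 1/3" | "1/3 \<le> t" "t \<le> 2/3" | "2/3 \<le> t" by linarith
        then show ?thesis by cases (simp_all add: x_def y_def)
      qed
      then show ?thesis
        using xy01[OF t] H(4-8) one by (auto simp: k_def)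
    qed
  qed
qed

section \<open>Length\<close>

lemma path_sum_le_path_length:
  assumes "lip_path M \<gamma>" "t 0 = (0::real)" "t n = 1" "\<And>i. i < n \<Longrightarrow> t i \<le> t (Suc i)"
  shows "(\<Sum>i<n. dist (\<gamma> (t i)) (\<gamma> (t (Suc i)))) \<le> path_length \<gamma>"
proof -
  obtain L where "L-lipschitz_on {0..1} \<gamma>" using assms(1) unfolding lip_path_def by blast
  then show ?thesis unfolding path_length_def
    by (intro cSup_upper path_sums_bdd_above) (use assms in \<open>auto simp: path_sums_def\<close>)
qed

lemma dist_le_path_length:
  assumes "lip_path M \<gamma>" "s \<in> {0..1}"
  shows "dist (\<gamma> 0) (\<gamma> s) \<le> path_length \<gamma>"
proof -
  define t where "t i = (if i = 0 then 0 else if i = 1 then s else 1)" for i :: nat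
  have "(\<Sum>i<2. dist (\<gamma> (t i)) (\<gamma> (t (Suc i)))) \<le> path_length \<gamma>"
    using assms(2) by (intro path_sum_le_path_length[OF assms(1)]) (auto simp: t_def)
  moreover have "(\<Sum>i<2. dist (\<gamma> (t i)) (\<gamma> (t (Suc i)))) = dist (\<gamma> 0) (\<gamma> s) + dist (\<gamma> s) (\<gamma> 1)"
    by (simp add: t_def numeral_2_eq_2)
  ultimately show ?thesis using zero_le_dist[of "\<gamma> s" "\<gamma> 1"] by linarith
qed

lemma path_length_nonneg: "lip_path M \<gamma> \<Longrightarrow> 0 \<le> path_length \<gamma>"
  using dist_le_path_length[of M \<gamma> 0] by simp

lemma path_length_const: "path_length (\<lambda>_. p) = 0"
proof -
  have "path_sums (\<lambda>_. p) = {0}"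
    using path_sums_nonempty[of "\<lambda>_. p"] by (auto simp: path_sums_def)
  then show ?thesis by (simp add: path_length_def)
qed

lemma path_sums_reversepath_subset: "path_sums (reversepath \<gamma>) \<subseteq> path_sums \<gamma>"
proof
  fix x assume "x \<in> path_sums (reversepath \<gamma>)"
  then obtain n t where x: "x = (\<Sum>i<n. dist (reversepath \<gamma> (t i)) (reversepath \<gamma> (t (Suc i))))"
    and t: "t 0 = (0::real)" "t n = 1" "\<forall>i<n. t i \<le> t (Suc i)"
    unfolding path_sums_def by blast
  define u where "u i = 1 - t (n - i)" for i
  have "x = (\<Sum>i<n. dist (\<gamma> (1 - t (n - Suc i))) (\<gamma> (1 - t (Suc (n - Suc i)))))"
    unfolding x reversepath_def
    by (rule sum.nat_diff_reindex[symmetric])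
  also have "\<dots> = (\<Sum>i<n. dist (\<gamma> (u i)) (\<gamma> (u (Suc i))))"
    by (intro sum.cong refl) (simp add: u_def dist_commute Suc_diff_Suc)
  finally have "x = (\<Sum>i<n. dist (\<gamma> (u i)) (\<gamma> (u (Suc i))))" .
  moreover have "u i \<le> u (Suc i)" if "i < n" for i
  proof -
    have "t (n - Suc i) \<le> t (Suc (n - Suc i))" using t(3) that by simp
    then show ?thesis using that by (simp add: u_def Suc_diff_Suc)
  qed
  ultimately show "x \<in> path_sums \<gamma>"
    unfolding path_sums_def using t by (auto simp: u_def intro!: exI[of _ n] exI[of _ u])
qed

lemma path_length_reversepath: "path_length (reversepath \<gamma>) = path_length \<gamma>"
  using path_sums_reversepath_subset[of \<gamma>] path_sums_reversepath_subset[of "reversepath \<gamma>"]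
  by (simp add: path_length_def reversepath_reversepath)

text \<open>
  A partition \<open>t\<close> of \<open>[0, 1]\<close> induces partitions of both halves by way of \<open>min (t i) (1/2)\<close> and
  \<open>max (t i) (1/2)\<close>. Where \<open>t\<close> does not cross \<open>1/2\<close>, one of the two summands vanishes; where it
  does, the triangle inequality at the junction applies.
\<close>

lemma path_length_joinpaths_le:
  assumes \<gamma>: "lip_path M \<gamma>" and \<delta>: "lip_path M \<delta>" and eq: "pathfinish \<gamma> = pathstart \<delta>"
  shows "path_length (\<gamma> +++ \<delta>) \<le> path_length \<gamma> + path_length \<delta>"
  unfolding path_length_def[of "\<gamma> +++ \<delta>"]
proof (rule cSup_least[OF path_sums_nonempty])
  fix x assume "x \<in> path_sums (\<gamma> +++ \<delta>)"
  then obtain n t where x: "x = (\<Sum>i<n. dist ((\<gamma> +++ \<delta>) (t i)) ((\<gamma> +++ \<delta>) (t (Suc i))))"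
    and t: "t 0 = (0::real)" "t n = 1" "\<forall>i<n. t i \<le> t (Suc i)"
    unfolding path_sums_def by blast
  define u v where "u i = 2 * min (t i) (1/2)" and "v i = 2 * max (t i) (1/2) - 1" for i
  have junction: "\<gamma> 1 = \<delta> 0" using eq by (simp add: pathfinish_def pathstart_def)
  have "dist ((\<gamma> +++ \<delta>) (t i)) ((\<gamma> +++ \<delta>) (t (Suc i)))
      \<le> dist (\<gamma> (u i)) (\<gamma> (u (Suc i))) + dist (\<delta> (v i)) (\<delta> (v (Suc i)))" if "i < n" for i
  proof -
    have mono: "t i \<le> t (Suc i)" using t(3) that by blast
    consider "t (Suc i) \<le> 1/2" | "1/2 < t i" | "t i \<le> 1/2" "1/2 < t (Suc i)" by linarith
    then show ?thesis
    proof cases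
      case 3
      then show ?thesis
        using dist_triangle[of "\<gamma> (2 * t i)" "\<delta> (2 * t (Suc i) - 1)" "\<delta> 0"]
        by (simp add: joinpaths_def u_def v_def junction)
    qed (use mono in \<open>auto simp: joinpaths_def u_def v_def\<close>)
  qed
  then have "x \<le> (\<Sum>i<n. dist (\<gamma> (u i)) (\<gamma> (u (Suc i)))) + (\<Sum>i<n. dist (\<delta> (v i)) (\<delta> (v (Suc i))))"
    unfolding x sum.distrib[symmetric] by (intro sum_mono) simp
  also have "\<dots> \<le> path_length \<gamma> + path_length \<delta>"
  proof (rule add_mono)
    show "(\<Sum>i<n. dist (\<gamma> (u i)) (\<gamma> (u (Suc i)))) \<le> path_length \<gamma>"
      using t by (intro path_sum_le_path_length[OF \<gamma>]) (auto simp: u_def min_def dest!: spec)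
    show "(\<Sum>i<n. dist (\<delta> (v i)) (\<delta> (v (Suc i)))) \<le> path_length \<delta>"
      using t by (intro path_sum_le_path_length[OF \<delta>]) (auto simp: v_def max_def dest!: spec)
  qed
  finally show "x \<le> path_length \<gamma> + path_length \<delta>" .
qed

section \<open>The lifted distance\<close>

lemma lip_class_eq_iff:
  assumes "lip_path M \<gamma>"
  shows "lip_class M \<gamma> = lip_class M \<gamma>' \<longleftrightarrow> lip_homotopic M \<gamma> \<gamma>'"
  using assms lip_homotopic_refl lip_homotopic_sym lip_homotopic_trans
  unfolding lip_class_def by blast

definition connecting_paths ::
    "'a::metric_space set \<Rightarrow> (real \<Rightarrow> 'a) \<Rightarrow> (real \<Rightarrow> 'a) \<Rightarrow> (real \<Rightarrow> 'a) set" where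
  "connecting_paths M \<gamma>\<^sub>1 \<gamma>\<^sub>2 = {\<beta>. lip_homotopic M \<beta> (reversepath \<gamma>\<^sub>1 +++ \<gamma>\<^sub>2)}"

lemma connecting_pathsD:
  assumes "\<beta> \<in> connecting_paths M \<gamma>\<^sub>1 \<gamma>\<^sub>2"
  shows "lip_homotopic M \<beta> (reversepath \<gamma>\<^sub>1 +++ \<gamma>\<^sub>2)" "lip_path M \<beta>"
    "pathstart \<beta> = pathfinish \<gamma>\<^sub>1" "pathfinish \<beta> = pathfinish \<gamma>\<^sub>2"
  using assms lip_homotopicD[of M \<beta> "reversepath \<gamma>\<^sub>1 +++ \<gamma>\<^sub>2"]
  by (auto simp: connecting_paths_def)

lemma bdd_below_connecting_lengths: "bdd_below (path_length ` connecting_paths M \<gamma>\<^sub>1 \<gamma>\<^sub>2)"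
  by (rule bdd_belowI[of _ 0]) (auto dest: connecting_pathsD(2) path_length_nonneg)

lemma connecting_paths_nonempty:
  assumes "lip_path M \<gamma>\<^sub>1" "lip_path M \<gamma>\<^sub>2" "pathstart \<gamma>\<^sub>1 = pathstart \<gamma>\<^sub>2"
  shows "connecting_paths M \<gamma>\<^sub>1 \<gamma>\<^sub>2 \<noteq> {}"
proof -
  have "lip_path M (reversepath \<gamma>\<^sub>1 +++ \<gamma>\<^sub>2)"
    using assms by (intro lip_path_joinpaths lip_path_reversepath) auto
  then show ?thesis unfolding connecting_paths_def using lip_homotopic_refl by blast
qed

lemma reversepath_connecting_paths:
  assumes "\<beta> \<in> connecting_paths M \<gamma>\<^sub>1 \<gamma>\<^sub>2" "pathstart \<gamma>\<^sub>1 = pathstart \<gamma>\<^sub>2"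
  shows "reversepath \<beta> \<in> connecting_paths M \<gamma>\<^sub>2 \<gamma>\<^sub>1"
  using lip_homotopic_reversepath[OF connecting_pathsD(1)[OF assms(1)]] assms(2)
  by (simp add: connecting_paths_def reversepath_joinpaths)

lemma joinpaths_connecting_paths:
  assumes \<beta>: "\<beta> \<in> connecting_paths M \<gamma>\<^sub>1 \<gamma>\<^sub>2" and \<beta>': "\<beta>' \<in> connecting_paths M \<gamma>\<^sub>2 \<gamma>\<^sub>3"
    and paths: "lip_path M \<gamma>\<^sub>1" "lip_path M \<gamma>\<^sub>2" "lip_path M \<gamma>\<^sub>3"
    and starts: "pathstart \<gamma>\<^sub>1 = p" "pathstart \<gamma>\<^sub>2 = p" "pathstart \<gamma>\<^sub>3 = p"
  shows "\<beta> +++ \<beta>' \<in> connecting_paths M \<gamma>\<^sub>1 \<gamma>\<^sub>3"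
proof -
  have "lip_homotopic M (\<beta> +++ \<beta>') ((reversepath \<gamma>\<^sub>1 +++ \<gamma>\<^sub>2) +++ (reversepath \<gamma>\<^sub>2 +++ \<gamma>\<^sub>3))"
    using connecting_pathsD[OF \<beta>] connecting_pathsD[OF \<beta>']
    by (intro lip_homotopic_joinpaths) auto
  then show ?thesis
    using lip_homotopic_trans lip_homotopic_cancel_middle[OF paths starts]
    unfolding connecting_paths_def by blast
qed

text \<open>Changing the representatives does not change the homotopy class of \<open>\<gamma>\<^sub>1\<inverse> * \<gamma>\<^sub>2\<close>.\<close>

lemma lifted_dist_lip_class:
  assumes paths: "lip_path M \<gamma>\<^sub>1" "lip_path M \<gamma>\<^sub>2" and starts: "pathstart \<gamma>\<^sub>1 = p0" "pathstart \<gamma>\<^sub>2 = p0"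
  shows "lifted_dist M p0 (lip_class M \<gamma>\<^sub>1) (lip_class M \<gamma>\<^sub>2)
    = Inf (path_length ` connecting_paths M \<gamma>\<^sub>1 \<gamma>\<^sub>2)"
proof -
  have "lip_homotopic M \<beta> (reversepath \<gamma>\<^sub>1 +++ \<gamma>\<^sub>2)"
    if "lip_homotopic M \<gamma>\<^sub>1 \<delta>\<^sub>1" "lip_homotopic M \<gamma>\<^sub>2 \<delta>\<^sub>2"
      "lip_homotopic M \<beta> (reversepath \<delta>\<^sub>1 +++ \<delta>\<^sub>2)" for \<beta> \<delta>\<^sub>1 \<delta>\<^sub>2
  proof -
    have "lip_homotopic M (reversepath \<gamma>\<^sub>1 +++ \<gamma>\<^sub>2) (reversepath \<delta>\<^sub>1 +++ \<delta>\<^sub>2)"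
      using that starts by (intro lip_homotopic_joinpaths lip_homotopic_reversepath) auto
    then show ?thesis using that lip_homotopic_sym lip_homotopic_trans by blast
  qed
  then have "{path_length \<beta> |\<beta> \<delta>\<^sub>1 \<delta>\<^sub>2. \<delta>\<^sub>1 \<in> lip_class M \<gamma>\<^sub>1 \<and> \<delta>\<^sub>2 \<in> lip_class M \<gamma>\<^sub>2 \<and>
      lip_homotopic M \<beta> (reversepath \<delta>\<^sub>1 +++ \<delta>\<^sub>2)} = path_length ` connecting_paths M \<gamma>\<^sub>1 \<gamma>\<^sub>2"
    using lip_homotopic_refl[OF paths(1)] lip_homotopic_refl[OF paths(2)]
    unfolding lip_class_def connecting_paths_def by blast
  moreover have "lip_class M \<gamma>\<^sub>1 \<in> lip_path_space M p0" "lip_class M \<gamma>\<^sub>2 \<in> lip_path_space M p0"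
    using assms unfolding lip_path_space_def by auto
  ultimately show ?thesis unfolding lifted_dist_def by simp
qed

lemma lip_path_spaceE:
  assumes "A \<in> lip_path_space M p0"
  obtains \<gamma> where "A = lip_class M \<gamma>" "lip_path M \<gamma>" "pathstart \<gamma> = p0"
  using assms unfolding lip_path_space_def by blast

lemma lifted_dist_nonneg: "0 \<le> lifted_dist M p0 A B"
proof (cases "A \<in> lip_path_space M p0 \<and> B \<in> lip_path_space M p0")
  case True
  then obtain \<gamma>\<^sub>1 \<gamma>\<^sub>2 where A: "A = lip_class M \<gamma>\<^sub>1" "lip_path M \<gamma>\<^sub>1" "pathstart \<gamma>\<^sub>1 = p0"
    and B: "B = lip_class M \<gamma>\<^sub>2" "lip_path M \<gamma>\<^sub>2" "pathstart \<gamma>\<^sub>2 = p0"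
    by (metis lip_path_spaceE)
  have "0 \<le> Inf (path_length ` connecting_paths M \<gamma>\<^sub>1 \<gamma>\<^sub>2)"
    using connecting_paths_nonempty[of M \<gamma>\<^sub>1 \<gamma>\<^sub>2] A B
    by (intro cInf_greatest) (auto dest: connecting_pathsD(2) path_length_nonneg)
  then show ?thesis using lifted_dist_lip_class A B by metis
qed (auto simp: lifted_dist_def)

lemma lifted_dist_commute: "lifted_dist M p0 A B = lifted_dist M p0 B A"
proof (cases "A \<in> lip_path_space M p0 \<and> B \<in> lip_path_space M p0")
  case True
  then obtain \<gamma>\<^sub>1 \<gamma>\<^sub>2 where A: "A = lip_class M \<gamma>\<^sub>1" "lip_path M \<gamma>\<^sub>1" "pathstart \<gamma>\<^sub>1 = p0"
    and B: "B = lip_class M \<gamma>\<^sub>2" "lip_path M \<gamma>\<^sub>2" "pathstart \<gamma>\<^sub>2 = p0"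
    by (metis lip_path_spaceE)
  have "path_length ` connecting_paths M \<delta> \<delta>' \<subseteq> path_length ` connecting_paths M \<delta>' \<delta>"
    if "pathstart \<delta> = pathstart \<delta>'" for \<delta> \<delta>'
  proof
    fix x assume "x \<in> path_length ` connecting_paths M \<delta> \<delta>'"
    then obtain \<beta> where "\<beta> \<in> connecting_paths M \<delta> \<delta>'" "x = path_length \<beta>" by blast
    then show "x \<in> path_length ` connecting_paths M \<delta>' \<delta>"
      using reversepath_connecting_paths[OF _ that] path_length_reversepath by (metis imageI)
  qed
  then have "path_length ` connecting_paths M \<gamma>\<^sub>1 \<gamma>\<^sub>2 = path_length ` connecting_paths M \<gamma>\<^sub>2 \<gamma>\<^sub>1"
    using A B by (intro equalityI) auto
  then show ?thesis using lifted_dist_lip_class A B by metis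
qed (auto simp: lifted_dist_def)

lemma lifted_dist_le:
  assumes "lip_path M \<gamma>\<^sub>1" "lip_path M \<gamma>\<^sub>2" "pathstart \<gamma>\<^sub>1 = p0" "pathstart \<gamma>\<^sub>2 = p0"
    and "\<beta> \<in> connecting_paths M \<gamma>\<^sub>1 \<gamma>\<^sub>2"
  shows "lifted_dist M p0 (lip_class M \<gamma>\<^sub>1) (lip_class M \<gamma>\<^sub>2) \<le> path_length \<beta>"
  unfolding lifted_dist_lip_class[OF assms(1-4)]
  using assms(5) by (intro cInf_lower bdd_below_connecting_lengths) auto

lemma connecting_path_shorter_than:
  assumes "lip_path M \<gamma>\<^sub>1" "lip_path M \<gamma>\<^sub>2" "pathstart \<gamma>\<^sub>1 = p0" "pathstart \<gamma>\<^sub>2 = p0"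
    and "lifted_dist M p0 (lip_class M \<gamma>\<^sub>1) (lip_class M \<gamma>\<^sub>2) < c"
  obtains \<beta> where "\<beta> \<in> connecting_paths M \<gamma>\<^sub>1 \<gamma>\<^sub>2" "path_length \<beta> < c"
proof -
  have "path_length ` connecting_paths M \<gamma>\<^sub>1 \<gamma>\<^sub>2 \<noteq> {}"
    using connecting_paths_nonempty[OF assms(1,2)] assms(3,4) by simp
  from cInf_lessD[OF this assms(5)[unfolded lifted_dist_lip_class[OF assms(1-4)]]]
  show ?thesis using that by blast
qed

lemma lifted_dist_triangle:
  assumes "A \<in> lip_path_space M p0" "B \<in> lip_path_space M p0" "C \<in> lip_path_space M p0"
  shows "lifted_dist M p0 A C \<le> lifted_dist M p0 A B + lifted_dist M p0 B C"
proof (rule field_le_epsilon)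
  fix e :: real assume "0 < e"
  obtain \<gamma>\<^sub>1 where A: "A = lip_class M \<gamma>\<^sub>1" and \<gamma>\<^sub>1: "lip_path M \<gamma>\<^sub>1" "pathstart \<gamma>\<^sub>1 = p0"
    using assms(1) by (rule lip_path_spaceE)
  obtain \<gamma>\<^sub>2 where B: "B = lip_class M \<gamma>\<^sub>2" and \<gamma>\<^sub>2: "lip_path M \<gamma>\<^sub>2" "pathstart \<gamma>\<^sub>2 = p0"
    using assms(2) by (rule lip_path_spaceE)
  obtain \<gamma>\<^sub>3 where C: "C = lip_class M \<gamma>\<^sub>3" and \<gamma>\<^sub>3: "lip_path M \<gamma>\<^sub>3" "pathstart \<gamma>\<^sub>3 = p0"
    using assms(3) by (rule lip_path_spaceE)
  obtain \<beta> where \<beta>: "\<beta> \<in> connecting_paths M \<gamma>\<^sub>1 \<gamma>\<^sub>2" "path_length \<beta> < lifted_dist M p0 A B + e / 2"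
    using connecting_path_shorter_than[OF \<gamma>\<^sub>1(1) \<gamma>\<^sub>2(1) \<gamma>\<^sub>1(2) \<gamma>\<^sub>2(2), of "lifted_dist M p0 A B + e / 2"]
      \<open>0 < e\<close> unfolding A B by auto
  obtain \<beta>' where \<beta>': "\<beta>' \<in> connecting_paths M \<gamma>\<^sub>2 \<gamma>\<^sub>3" "path_length \<beta>' < lifted_dist M p0 B C + e / 2"
    using connecting_path_shorter_than[OF \<gamma>\<^sub>2(1) \<gamma>\<^sub>3(1) \<gamma>\<^sub>2(2) \<gamma>\<^sub>3(2), of "lifted_dist M p0 B C + e / 2"]
      \<open>0 < e\<close> unfolding B C by auto
  have "lifted_dist M p0 A C \<le> path_length (\<beta> +++ \<beta>')"
    unfolding A C using \<gamma>\<^sub>1 \<gamma>\<^sub>2 \<gamma>\<^sub>3 \<beta>(1) \<beta>'(1)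
    by (intro lifted_dist_le joinpaths_connecting_paths[where \<gamma>\<^sub>2 = \<gamma>\<^sub>2]) auto
  also have "\<dots> \<le> path_length \<beta> + path_length \<beta>'"
    using connecting_pathsD[OF \<beta>(1)] connecting_pathsD[OF \<beta>'(1)]
    by (intro path_length_joinpaths_le) auto
  finally show "lifted_dist M p0 A C \<le> lifted_dist M p0 A B + lifted_dist M p0 B C + e"
    using \<beta>(2) \<beta>'(2) by simp
qed

lemma lifted_dist_self:
  assumes "A \<in> lip_path_space M p0"
  shows "lifted_dist M p0 A A = 0"
proof -
  obtain \<gamma> where A: "A = lip_class M \<gamma>" and \<gamma>: "lip_path M \<gamma>" "pathstart \<gamma> = p0"
    using assms by (rule lip_path_spaceE)
  have "(\<lambda>_. pathfinish \<gamma>) \<in> connecting_paths M \<gamma> \<gamma>"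
    using lip_homotopic_const_reversepath_join[OF \<gamma>(1)] by (simp add: connecting_paths_def)
  from lifted_dist_le[OF \<gamma>(1) \<gamma>(1) \<gamma>(2) \<gamma>(2) this]
  have "lifted_dist M p0 A A \<le> 0" by (simp add: path_length_const A)
  then show ?thesis using lifted_dist_nonneg[of M p0 A A] by simp
qed

section \<open>Local representability\<close>

lemma locally_representable_if_short_representatives:
  assumes "\<And>e. 0 < e \<Longrightarrow> \<exists>\<beta>\<in>A. lip_path M \<beta> \<and> pathstart \<beta> = p \<and> path_length \<beta> < e"
  shows "locally_representable M p A"
  unfolding locally_representable_def
proof (intro allI impI, elim conjE exE)
  fix U V assume V: "openin (top_of_set M) V" "p \<in> V" "V \<subseteq> U"
  then obtain e where e: "0 < e" "\<And>x. x \<in> M \<Longrightarrow> dist x p < e \<Longrightarrow> x \<in> V"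
    unfolding openin_euclidean_subtopology_iff by blast
  obtain \<beta> where \<beta>: "\<beta> \<in> A" "lip_path M \<beta>" "pathstart \<beta> = p" "path_length \<beta> < e"
    using assms[OF e(1)] by blast
  have "\<beta> s \<in> V" if "s \<in> {0..1}" for s
  proof (rule e(2))
    show "\<beta> s \<in> M" using \<beta>(2) that by (auto simp: lip_path_iff)
    show "dist (\<beta> s) p < e"
      using dist_le_path_length[OF \<beta>(2) that] \<beta>(3,4) by (simp add: pathstart_def dist_commute)
  qed
  then have "path_image \<beta> \<subseteq> U" using V(3) by (auto simp: path_image_def)
  then show "\<exists>\<alpha>\<in>A. path_image \<alpha> \<subseteq> U" using \<beta>(1) by blast
qed

text \<open>
  Local triviality is assumed only at the end point of \<open>\<gamma>\<^sub>1\<close>, so that the fundamental group, where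
  this is the base point, and the path space, where it can be any point of \<open>M\<close>, are both covered.
  The short representatives of \<open>\<gamma>\<^sub>1\<inverse> * \<gamma>\<^sub>2\<close> first close this path up to a loop and then make its
  class locally representable.
\<close>

lemma lifted_dist_zero_imp_eq:
  assumes A: "A = lip_class M \<gamma>\<^sub>1" and \<gamma>\<^sub>1: "lip_path M \<gamma>\<^sub>1" "pathstart \<gamma>\<^sub>1 = p0"
    and "B \<in> lip_path_space M p0"
    and triv: "only_trivial_local_rep M (pathfinish \<gamma>\<^sub>1)"
    and d0: "lifted_dist M p0 A B = 0"
  shows "A = B"
proof -
  define p where "p = pathfinish \<gamma>\<^sub>1"
  obtain \<gamma>\<^sub>2 where B: "B = lip_class M \<gamma>\<^sub>2" and \<gamma>\<^sub>2: "lip_path M \<gamma>\<^sub>2" "pathstart \<gamma>\<^sub>2 = p0"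
    using assms(4) by (rule lip_path_spaceE)
  have short: "\<exists>\<beta>\<in>connecting_paths M \<gamma>\<^sub>1 \<gamma>\<^sub>2. path_length \<beta> < e" if "0 < e" for e
    using connecting_path_shorter_than[OF \<gamma>\<^sub>1(1) \<gamma>\<^sub>2(1) \<gamma>\<^sub>1(2) \<gamma>\<^sub>2(2), of e] d0 that
    unfolding A B by auto
  have "dist p (pathfinish \<gamma>\<^sub>2) < e" if e: "0 < e" for e
  proof -
    obtain \<beta> where \<beta>: "\<beta> \<in> connecting_paths M \<gamma>\<^sub>1 \<gamma>\<^sub>2" "path_length \<beta> < e" using short[OF e] by blast
    have "dist (pathstart \<beta>) (pathfinish \<beta>) \<le> path_length \<beta>"
      using dist_le_path_length[OF connecting_pathsD(2)[OF \<beta>(1)], of 1]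
      by (simp add: pathstart_def pathfinish_def)
    then show ?thesis using \<beta>(2) connecting_pathsD(3,4)[OF \<beta>(1)] by (simp add: p_def)
  qed
  then have ends: "pathfinish \<gamma>\<^sub>2 = p"
    by (metis less_irrefl zero_less_dist_iff)
  let ?W = "reversepath \<gamma>\<^sub>1 +++ \<gamma>\<^sub>2"
  have W: "lip_path M ?W" "pathstart ?W = p" "pathfinish ?W = p"
    using \<gamma>\<^sub>1 \<gamma>\<^sub>2 ends by (auto simp: p_def intro!: lip_path_joinpaths lip_path_reversepath)
  have "locally_representable M p (lip_class M ?W)"
  proof (rule locally_representable_if_short_representatives)
    fix e :: real assume "0 < e"
    then obtain \<beta> where \<beta>: "\<beta> \<in> connecting_paths M \<gamma>\<^sub>1 \<gamma>\<^sub>2" "path_length \<beta> < e" using short by blast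
    then show "\<exists>\<beta>\<in>lip_class M ?W. lip_path M \<beta> \<and> pathstart \<beta> = p \<and> path_length \<beta> < e"
      using connecting_pathsD[OF \<beta>(1)] lip_homotopic_sym
      by (intro bexI[of _ \<beta>]) (auto simp: p_def lip_class_def)
  qed
  moreover have "lip_class M ?W \<in> lip_pi1 M p" using W unfolding lip_pi1_def by blast
  ultimately have "lip_class M ?W = lip_class M (\<lambda>_. p)"
    using triv unfolding only_trivial_local_rep_def p_def by blast
  then have "lip_homotopic M ?W (\<lambda>_. p)" using lip_class_eq_iff[OF W(1)] by simp
  then have "lip_homotopic M \<gamma>\<^sub>1 \<gamma>\<^sub>2"
    by (rule lip_homotopic_if_null) (simp add: \<gamma>\<^sub>1 \<gamma>\<^sub>2)
  then show ?thesis unfolding A B using lip_class_eq_iff[OF \<gamma>\<^sub>1(1)] by simp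
qed

lemma Metric_space_lifted_dist:
  assumes S: "S \<subseteq> lip_path_space M p0"
    and triv: "\<And>A. A \<in> S \<Longrightarrow> \<exists>\<gamma>. A = lip_class M \<gamma> \<and> lip_path M \<gamma> \<and> pathstart \<gamma> = p0 \<and>
      only_trivial_local_rep M (pathfinish \<gamma>)"
  shows "Metric_space S (lifted_dist M p0)"
proof
  show "lifted_dist M p0 A B = 0 \<longleftrightarrow> A = B" if AB: "A \<in> S" "B \<in> S" for A B
  proof
    assume d0: "lifted_dist M p0 A B = 0"
    obtain \<gamma> where \<gamma>: "A = lip_class M \<gamma>" "lip_path M \<gamma>" "pathstart \<gamma> = p0"
      "only_trivial_local_rep M (pathfinish \<gamma>)"
      using triv[OF AB(1)] by blast
    show "A = B"
      using lifted_dist_zero_imp_eq[OF \<gamma>(1-3) subsetD[OF S AB(2)] \<gamma>(4) d0] .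
  next
    assume "A = B"
    then show "lifted_dist M p0 A B = 0" using S AB(1) lifted_dist_self by blast
  qed
  show "lifted_dist M p0 A C \<le> lifted_dist M p0 A B + lifted_dist M p0 B C"
    if "A \<in> S" "B \<in> S" "C \<in> S" for A B C
    using that S by (intro lifted_dist_triangle) auto
qed (rule lifted_dist_nonneg lifted_dist_commute)+

theorem lemma2p9:
  fixes M :: "'a::metric_space set" and p0 :: 'a
  assumes "p0 \<in> M"
    and "lip_path_connected M"
    and "\<exists>x\<in>M. \<exists>y\<in>M. x \<noteq> y"
  shows "(only_trivial_local_rep M p0 \<longrightarrow> Metric_space (lip_pi1 M p0) (lifted_dist M p0)) \<and>
         ((\<forall>p\<in>M. only_trivial_local_rep M p) \<longrightarrow>
            Metric_space (lip_path_space M p0) (lifted_dist M p0))"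
proof (intro conjI impI)
  assume "only_trivial_local_rep M p0"
  then show "Metric_space (lip_pi1 M p0) (lifted_dist M p0)"
    by (intro Metric_space_lifted_dist lip_pi1_subset_path_space) (auto simp: lip_pi1_def)
next
  assume triv: "\<forall>p\<in>M. only_trivial_local_rep M p"
  have "pathfinish \<gamma> \<in> M" if "lip_path M \<gamma>" for \<gamma>
    using that by (auto simp: lip_path_iff pathfinish_def)
  with triv show "Metric_space (lip_path_space M p0) (lifted_dist M p0)"
    by (intro Metric_space_lifted_dist subset_refl) (auto simp: lip_path_space_def)
qed

end
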